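(* Let $\mathcal{U}=\{\pmb{c}^1,\ldots,\pmb{c}^N\}\subseteq\mathbb{R}^n_+$ and $\mathcal{C}=\{\hat{\pmb{c}}^1,\ldots,\hat{\pmb{c}}^K\}\subseteq\mathbb{R}^n_+$ be such that, for some $\alpha,\beta\ge 0$, (i) for all $i\in[N]$ there exists $\hat{\pmb{c}}\in\mathrm{conv}(\mathcal{C})$ with $\pmb{c}^i\le\alpha\hat{\pmb{c}}$; and (ii) for all $k\in[K]$ there exists $\pmb{c}\in\mathrm{conv}(\mathcal{U})$ with $\hat{\pmb{c}}^k\le\beta\pmb{c}$. Then, for every feasible set $\mathcal{X}\subseteq\mathbb{R}^n_+$, any optimal solution to the one-stage robust optimization problem with respect to $\mathcal{C}$ is an $\alpha\beta$-approximation to the one-stage robust optimization problem with respect to $\mathcal{U}$.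
   Context: $[N]=\{1,\ldots,N\}$; $\mathbb{R}^n_+$ is the set of vectors in $\mathbb{R}^n$ with nonnegative entries; inequalities between vectors are componentwise; $\mathrm{conv}$ denotes the convex hull. Given a set of feasible solutions $\mathcal{X}\subseteq\mathbb{R}^n_+$ and a finite nonempty set $\mathcal{V}\subseteq\mathbb{R}^n_+$, the one-stage robust optimization problem with respect to $\mathcal{V}$ is $\min_{\pmb{x}\in\mathcal{X}}\max_{\pmb{c}\in\mathcal{V}}\pmb{c}^\intercal\pmb{x}$. For $\rho\ge 0$, a solution $\hat{\pmb{x}}\in\mathcal{X}$ is a $\rho$-approximation to the problem with respect to $\mathcal{U}$ if $\max_{\pmb{c}\in\mathcal{U}}\pmb{c}^\intercal\hat{\pmb{x}}\le\rho\cdot\min_{\pmb{x}\in\mathcal{X}}\max_{\pmb{c}\in\mathcal{U}}\pmb{c}^\intercal\pmb{x}$, where (as throughout) the minima that are written are assumed to be attained. *)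

theory Defs
  imports "HOL-Analysis.Analysis"
begin

text \<open>
  Vectors are elements of \<^typ>\<open>real ^ 'n\<close>; \<open>\<le>\<close> on them is the componentwise order, so
  \<open>{0..}\<close> is the nonnegative orthant.
\<close>

definition worst_case_cost :: "(real ^ 'n) set \<Rightarrow> real ^ 'n \<Rightarrow> real" where
  "worst_case_cost V x = Max ((\<lambda>c. c \<bullet> x) ` V)"

definition robust_optimal :: "(real ^ 'n) set \<Rightarrow> (real ^ 'n) set \<Rightarrow> real ^ 'n \<Rightarrow> bool" where
  "robust_optimal X V x \<longleftrightarrow> is_arg_min (worst_case_cost V) (\<lambda>y. y \<in> X) x"

text \<open>
  The minimum of the worst-case cost over \<open>X\<close>. As \<open>Least\<close> is an underspecified description, this
  is meaningful only if the minimum is attained, i.e. if \<open>robust_optimal X V x\<close> for some \<open>x\<close>.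
\<close>

definition robust_value :: "(real ^ 'n) set \<Rightarrow> (real ^ 'n) set \<Rightarrow> real" where
  "robust_value X V = (LEAST v. v \<in> worst_case_cost V ` X)"

definition robust_approx ::
  "real \<Rightarrow> (real ^ 'n) set \<Rightarrow> (real ^ 'n) set \<Rightarrow> real ^ 'n \<Rightarrow> bool" where
  "robust_approx \<rho> X U x \<longleftrightarrow> x \<in> X \<and> worst_case_cost U x \<le> \<rho> * robust_value X U"

end

theory Submission
  imports Defs
begin

text \<open>
  A linear functional on the convex hull of a finite set is bounded by its maximum over that set,
  so passing to convex hulls does not change worst-case costs. On nonnegative \<open>x\<close> the cost is
  moreover monotone in the cost vector. Hence, if every vector of \<open>V\<close> lies below \<open>\<gamma>\<close> times a point
  of \<open>convex hull W\<close>, the worst-case cost of \<open>x\<close> over \<open>V\<close> is at most \<open>\<gamma>\<close> times that over \<open>W\<close>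
  (\<open>worst_case_cost_le_scaled\<close>). Using this once in each direction around the optimality of
  \<open>x_hat\<close> for \<open>C\<close> gives, for an optimal solution \<open>z\<close> with respect to \<open>U\<close>, the chain
  \<open>cost U x_hat \<le> \<alpha> * cost C x_hat \<le> \<alpha> * cost C z \<le> \<alpha> * \<beta> * cost U z\<close>.
\<close>

lemma inner_mono_cost:
  fixes a b x :: "real ^ 'n"
  assumes "a \<le> b" and "0 \<le> x"
  shows "a \<bullet> x \<le> b \<bullet> x"
  using assms by (auto simp: inner_vec_def less_eq_vec_def intro!: sum_mono mult_right_mono)

text \<open>
  The vectors whose cost is at most the worst-case cost form a half-space; being convex and
  containing \<open>V\<close>, it contains the convex hull.
\<close>

lemma inner_le_worst_case_cost_hull:
  assumes "finite V" and "d \<in> convex hull V"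
  shows "d \<bullet> x \<le> worst_case_cost V x"
proof -
  have "V \<subseteq> {c. x \<bullet> c \<le> worst_case_cost V x}"
    using assms(1) by (auto simp: worst_case_cost_def inner_commute intro!: Max_ge)
  then have "convex hull V \<subseteq> {c. x \<bullet> c \<le> worst_case_cost V x}"
    by (rule hull_minimal) (rule convex_halfspace_le)
  with assms(2) show ?thesis by (auto simp: inner_commute)
qed

lemma worst_case_cost_le_scaled:
  assumes "finite V" and "V \<noteq> {}" and "finite W" and "0 \<le> \<gamma>" and "0 \<le> x"
    and dom: "\<And>v. v \<in> V \<Longrightarrow> \<exists>d\<in>convex hull W. v \<le> \<gamma> *\<^sub>R d"
  shows "worst_case_cost V x \<le> \<gamma> * worst_case_cost W x"
proof -
  have "v \<bullet> x \<le> \<gamma> * worst_case_cost W x" if "v \<in> V" for v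
  proof -
    obtain d where d: "d \<in> convex hull W" "v \<le> \<gamma> *\<^sub>R d"
      using dom \<open>v \<in> V\<close> by blast
    have "v \<bullet> x \<le> (\<gamma> *\<^sub>R d) \<bullet> x"
      using d(2) \<open>0 \<le> x\<close> by (rule inner_mono_cost)
    also have "\<dots> = \<gamma> * (d \<bullet> x)" by simp
    also have "\<dots> \<le> \<gamma> * worst_case_cost W x"
      using inner_le_worst_case_cost_hull[OF \<open>finite W\<close> d(1)] \<open>0 \<le> \<gamma>\<close>
      by (rule mult_left_mono)
    finally show ?thesis .
  qed
  with assms(1,2) show ?thesis by (simp add: worst_case_cost_def)
qed

lemma robust_optimal_iff:
  "robust_optimal X V z \<longleftrightarrow>
    z \<in> X \<and> (\<forall>x\<in>X. worst_case_cost V z \<le> worst_case_cost V x)"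
  by (auto simp: robust_optimal_def is_arg_min_linorder)

lemma robust_value_eq:
  assumes "robust_optimal X V z"
  shows "robust_value X V = worst_case_cost V z"
  unfolding robust_value_def
  using assms by (intro Least_equality) (auto simp: robust_optimal_iff)

theorem theorem2:
  fixes c c_hat :: "nat \<Rightarrow> real ^ 'n"
    and U C X :: "(real ^ 'n) set"
    and N K :: nat
    and \<alpha> \<beta> :: real
    and x_hat :: "real ^ 'n"
  assumes "N \<ge> 1" and "K \<ge> 1"
    and "U = c ` {1..N}" and "U \<subseteq> {0..}"
    and "C = c_hat ` {1..K}" and "C \<subseteq> {0..}"
    and "\<alpha> \<ge> 0" and "\<beta> \<ge> 0"
    and "\<forall>i\<in>{1..N}. \<exists>d\<in>convex hull C. c i \<le> \<alpha> *\<^sub>R d"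
    and "\<forall>k\<in>{1..K}. \<exists>d\<in>convex hull U. c_hat k \<le> \<beta> *\<^sub>R d"
    and "X \<subseteq> {0..}"
    and "\<exists>x. robust_optimal X U x"
    and "robust_optimal X C x_hat"
  shows "robust_approx (\<alpha> * \<beta>) X U x_hat"
proof -
  obtain z where z: "robust_optimal X U z"
    using assms(12) by blast
  have zX: "z \<in> X" and hX: "x_hat \<in> X"
    and opt: "worst_case_cost C x_hat \<le> worst_case_cost C z"
    using z assms(13) by (auto simp: robust_optimal_iff)
  then have nonneg: "0 \<le> z" "0 \<le> x_hat"
    using assms(11) by auto
  have finU: "finite U" "U \<noteq> {}" and finC: "finite C" "C \<noteq> {}"
    using assms(1-3,5) by auto
  have "worst_case_cost U x_hat \<le> \<alpha> * worst_case_cost C x_hat"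
    using assms(3,7,9) finU finC(1) nonneg(2) by (intro worst_case_cost_le_scaled) auto
  also have "\<dots> \<le> \<alpha> * worst_case_cost C z"
    using opt assms(7) by (rule mult_left_mono)
  also have "\<dots> \<le> \<alpha> * (\<beta> * worst_case_cost U z)"
  proof (rule mult_left_mono)
    show "worst_case_cost C z \<le> \<beta> * worst_case_cost U z"
      using assms(5,8,10) finC finU(1) nonneg(1) by (intro worst_case_cost_le_scaled) auto
  qed (fact assms(7))
  also have "\<dots> = \<alpha> * \<beta> * robust_value X U"
    using robust_value_eq[OF z] by simp
  finally show ?thesis
    using hX by (simp add: robust_approx_def)
qed

end
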